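(* Let $E$ be a right $\mathbb H$-vector space with dual $E'$ (a left $\mathbb H$-vector space). Any balanced $\mathbb R$-bilinear form $\Phi:E\times E'\to\mathbb R$ is the real part of a left and right $\mathbb H$-linear form $\Psi:E'\times E\to\mathbb H$; that is, there is such a $\Psi$ with $\Phi(x,x')=\mathrm{Re}(\Psi(x',x))$ for all $x\in E$, $x'\in E'$.
   Context: $\mathbb H$ denotes the quaternions. A right (left) $\mathbb H$-vector space also carries a real-linear structure in which real scalars commute. $\Phi:E\times E'\to\mathbb R$ is a balanced $\mathbb R$-bilinear form if it is additive in each variable, $\Phi(xq,x')=\Phi(x,qx')$ for all $q\in\mathbb H$, and $r\Phi(x,x')=\Phi(rx,x')=\Phi(x,rx')$ for all $r\in\mathbb R$. A left and right $\mathbb H$-linear form $\Psi:E'\times E\to\mathbb H$ is a map additive in each variable with $\Psi(qx',x)=q\Psi(x',x)$ and $\Psi(x',xq)=\Psi(x',x)q$ for all $q\in\mathbb H$. *)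

theory Defs
  imports Complex_Main "HOL-Library.Function_Algebras"
begin

datatype quat = Quat (qRe: real) (qIm1: real) (qIm2: real) (qIm3: real)

lemma quat_eq_iff:
  "p = q \<longleftrightarrow> qRe p = qRe q \<and> qIm1 p = qIm1 q \<and> qIm2 p = qIm2 q \<and> qIm3 p = qIm3 q"
  by (cases p; cases q) simp

instantiation quat :: ab_group_add
begin
definition "0 = Quat 0 0 0 0"
definition "p + q = Quat (qRe p + qRe q) (qIm1 p + qIm1 q) (qIm2 p + qIm2 q) (qIm3 p + qIm3 q)"
definition "- p = Quat (- qRe p) (- qIm1 p) (- qIm2 p) (- qIm3 p)"
definition "p - q = Quat (qRe p - qRe q) (qIm1 p - qIm1 q) (qIm2 p - qIm2 q) (qIm3 p - qIm3 q)"
instance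
  by standard (simp_all add: quat_eq_iff zero_quat_def plus_quat_def uminus_quat_def minus_quat_def)
end

instantiation quat :: real_vector
begin
definition "scaleR r p = Quat (r * qRe p) (r * qIm1 p) (r * qIm2 p) (r * qIm3 p)"
instance
  by standard (simp_all add: quat_eq_iff plus_quat_def scaleR_quat_def algebra_simps)
end

instantiation quat :: real_algebra_1
begin
definition "1 = Quat 1 0 0 0"
definition "p * q = Quat
  (qRe p * qRe q - qIm1 p * qIm1 q - qIm2 p * qIm2 q - qIm3 p * qIm3 q)
  (qRe p * qIm1 q + qIm1 p * qRe q + qIm2 p * qIm3 q - qIm3 p * qIm2 q)
  (qRe p * qIm2 q - qIm1 p * qIm3 q + qIm2 p * qRe q + qIm3 p * qIm1 q)
  (qRe p * qIm3 q + qIm1 p * qIm2 q - qIm2 p * qIm1 q + qIm3 p * qRe q)"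
instance
  by standard (simp_all add: quat_eq_iff zero_quat_def one_quat_def plus_quat_def
      times_quat_def scaleR_quat_def algebra_simps)
end

definition quat_norm_sq :: "quat \<Rightarrow> real" where
  "quat_norm_sq q = (qRe q)\<^sup>2 + (qIm1 q)\<^sup>2 + (qIm2 q)\<^sup>2 + (qIm3 q)\<^sup>2"

lemma quat_norm_sq_eq_0_iff: "quat_norm_sq q = 0 \<longleftrightarrow> q = 0"
proof -
  have *: "a + b = 0 \<longleftrightarrow> a = 0 \<and> b = 0" if "a \<ge> 0" "b \<ge> 0" for a b :: real
    using that by linarith
  show ?thesis
    by (simp add: quat_norm_sq_def quat_eq_iff zero_quat_def *)
qed

instantiation quat :: division_ring
begin
definition "inverse q =
  scaleR (1 / quat_norm_sq q) (Quat (qRe q) (- qIm1 q) (- qIm2 q) (- qIm3 q))"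
definition "p div (q :: quat) = p * inverse q"
instance
proof
  fix p q :: quat
  show "inverse q * q = 1" if "q \<noteq> 0"
  proof -
    have n: "quat_norm_sq q \<noteq> 0"
      using that by (simp add: quat_norm_sq_eq_0_iff)
    have "Quat (qRe q) (- qIm1 q) (- qIm2 q) (- qIm3 q) * q = scaleR (quat_norm_sq q) 1"
      by (simp add: quat_eq_iff times_quat_def scaleR_quat_def one_quat_def quat_norm_sq_def
          power2_eq_square algebra_simps)
    then show ?thesis
      using n by (simp add: inverse_quat_def)
  qed
  show "q * inverse q = 1" if "q \<noteq> 0"
  proof -
    have n: "quat_norm_sq q \<noteq> 0"
      using that by (simp add: quat_norm_sq_eq_0_iff)
    have "q * Quat (qRe q) (- qIm1 q) (- qIm2 q) (- qIm3 q) = scaleR (quat_norm_sq q) 1"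
      by (simp add: quat_eq_iff times_quat_def scaleR_quat_def one_quat_def quat_norm_sq_def
          power2_eq_square algebra_simps)
    then show ?thesis
      using n by (simp add: inverse_quat_def)
  qed
  show "p div q = p * inverse q"
    by (simp add: divide_quat_def)
  show "inverse (0 :: quat) = 0"
    by (simp add: inverse_quat_def quat_eq_iff zero_quat_def scaleR_quat_def)
qed
end

text \<open>The library's \<open>module\<close> and \<open>vector_space\<close> require commutative scalars. A right space is
  carried by a whole type, whereas a left space has an explicit carrier set, because the dual
  below is a proper subset of a function type.\<close>

locale right_quat_space =
  fixes rs :: "'e::ab_group_add \<Rightarrow> quat \<Rightarrow> 'e"
  assumes rs_add_left: "rs (x + y) q = rs x q + rs y q"
    and rs_add_right: "rs x (p + q) = rs x p + rs x q"
    and rs_mult: "rs x (p * q) = rs (rs x p) q"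
    and rs_one: "rs x 1 = x"

locale left_quat_space =
  fixes V :: "'f::ab_group_add set" and ls :: "quat \<Rightarrow> 'f \<Rightarrow> 'f"
  assumes zero_mem: "0 \<in> V"
    and add_mem: "x \<in> V \<Longrightarrow> y \<in> V \<Longrightarrow> x + y \<in> V"
    and uminus_mem: "x \<in> V \<Longrightarrow> - x \<in> V"
    and ls_mem: "x \<in> V \<Longrightarrow> ls q x \<in> V"
    and ls_add_right: "x \<in> V \<Longrightarrow> y \<in> V \<Longrightarrow> ls q (x + y) = ls q x + ls q y"
    and ls_add_left: "x \<in> V \<Longrightarrow> ls (p + q) x = ls p x + ls q x"
    and ls_mult: "x \<in> V \<Longrightarrow> ls (p * q) x = ls p (ls q x)"
    and ls_one: "x \<in> V \<Longrightarrow> ls 1 x = x"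

text \<open>This is the algebraic dual (no continuity); its addition is the pointwise one of
  \<open>Function_Algebras\<close>.\<close>

definition quat_dual :: "('e::ab_group_add \<Rightarrow> quat \<Rightarrow> 'e) \<Rightarrow> ('e \<Rightarrow> quat) set" where
  "quat_dual rs = {f. (\<forall>x y. f (x + y) = f x + f y) \<and> (\<forall>x q. f (rs x q) = f x * q)}"

definition dual_scale :: "quat \<Rightarrow> ('e \<Rightarrow> quat) \<Rightarrow> ('e \<Rightarrow> quat)" where
  "dual_scale q f = (\<lambda>x. q * f x)"

lemma left_quat_space_quat_dual: "left_quat_space (quat_dual rs) dual_scale"
  by standard (auto simp: quat_dual_def dual_scale_def fun_eq_iff algebra_simps)

text \<open>In both forms, \<open>rs\<close> is the scalar action on the right space and \<open>ls\<close> the one on the left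
  space \<open>V\<close>. The real structure is the restriction of the quaternionic one to the central
  subfield of real quaternions \<open>of_real r\<close>.\<close>

definition balanced_real_bilinear ::
  "('e::ab_group_add \<Rightarrow> quat \<Rightarrow> 'e) \<Rightarrow> 'f::ab_group_add set \<Rightarrow> (quat \<Rightarrow> 'f \<Rightarrow> 'f)
    \<Rightarrow> ('e \<Rightarrow> 'f \<Rightarrow> real) \<Rightarrow> bool" where
  "balanced_real_bilinear rs V ls \<Phi> \<longleftrightarrow>
     (\<forall>x y. \<forall>x'\<in>V. \<Phi> (x + y) x' = \<Phi> x x' + \<Phi> y x') \<and>
     (\<forall>x. \<forall>x'\<in>V. \<forall>y'\<in>V. \<Phi> x (x' + y') = \<Phi> x x' + \<Phi> x y') \<and>
     (\<forall>x. \<forall>x'\<in>V. \<forall>q. \<Phi> (rs x q) x' = \<Phi> x (ls q x')) \<and>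
     (\<forall>x. \<forall>x'\<in>V. \<forall>r::real. r * \<Phi> x x' = \<Phi> (rs x (of_real r)) x' \<and>
        r * \<Phi> x x' = \<Phi> x (ls (of_real r) x'))"

definition left_right_linear_form ::
  "('e::ab_group_add \<Rightarrow> quat \<Rightarrow> 'e) \<Rightarrow> 'f::ab_group_add set \<Rightarrow> (quat \<Rightarrow> 'f \<Rightarrow> 'f)
    \<Rightarrow> ('f \<Rightarrow> 'e \<Rightarrow> quat) \<Rightarrow> bool" where
  "left_right_linear_form rs V ls \<Psi> \<longleftrightarrow>
     (\<forall>x'\<in>V. \<forall>y'\<in>V. \<forall>x. \<Psi> (x' + y') x = \<Psi> x' x + \<Psi> y' x) \<and>
     (\<forall>x'\<in>V. \<forall>x y. \<Psi> x' (x + y) = \<Psi> x' x + \<Psi> x' y) \<and>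
     (\<forall>x'\<in>V. \<forall>x q. \<Psi> (ls q x') x = q * \<Psi> x' x) \<and>
     (\<forall>x'\<in>V. \<forall>x q. \<Psi> x' (rs x q) = \<Psi> x' x * q)"

end

theory Submission
  imports Defs
begin

text \<open>The pairing \<open>(a, q) \<mapsto> qRe (a * q)\<close> identifies the quaternions with their real dual: every
  real-linear functional on them is \<open>q \<mapsto> qRe (c * q)\<close> for exactly one \<open>c\<close>. For fixed \<open>x\<close> and
  \<open>x'\<close> the map \<open>q \<mapsto> \<Phi> (rs x q) x'\<close> is such a functional, and \<open>\<Psi> x' x\<close> is the quaternion that
  represents it. Taking \<open>q = 1\<close> shows that \<open>\<Phi>\<close> is the real part of \<open>\<Psi>\<close>.

  Nondegeneracy of the pairing lets each law of \<open>\<Psi>\<close> be checked after multiplying by an arbitrary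
  \<open>q\<close> on the right and taking real parts, where it becomes a law of \<open>\<Phi>\<close>. Right linearity is
  associativity of the action. Left linearity is the balancing condition combined with the trace
  property \<open>qRe (a * b) = qRe (b * a)\<close>:
  \<open>qRe (\<Psi> (p x') x * q) = \<Phi> (x q) (p x') = \<Phi> (x q p) x' = qRe (\<Psi> x' x * q * p)
  = qRe (p * \<Psi> x' x * q)\<close>.
  The argument pairs a right space with any left space, and the dual is one by
  \<open>left_quat_space_quat_dual\<close>.\<close>

lemma qRe_add: "qRe (p + q) = qRe p + qRe q"
  by (simp add: plus_quat_def)

lemma qRe_mult_commute: "qRe (p * q) = qRe (q * p)"
  by (simp add: times_quat_def)

text \<open>Pairing with \<open>1, i, j, k\<close> reads off the four coordinates up to sign.\<close>

lemma quat_eqI_qRe_mult: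
  assumes "\<And>q. qRe (a * q) = qRe (b * q)"
  shows "a = b"
  using assms[of "Quat 1 0 0 0"] assms[of "Quat 0 1 0 0"]
    assms[of "Quat 0 0 1 0"] assms[of "Quat 0 0 0 1"]
  by (simp add: times_quat_def quat_eq_iff)

lemma real_functional_eq_qRe_mult:
  fixes L :: "quat \<Rightarrow> real"
  assumes add: "\<And>p q. L (p + q) = L p + L q"
    and scale: "\<And>r q. L (q * of_real r) = r * L q"
  shows "\<exists>c. \<forall>q. L q = qRe (c * q)"
proof (intro exI allI)
  fix q
  let ?i = "Quat 0 1 0 0" and ?j = "Quat 0 0 1 0" and ?k = "Quat 0 0 0 1"
  have "q = 1 * of_real (qRe q) + ?i * of_real (qIm1 q) + ?j * of_real (qIm2 q)
      + ?k * of_real (qIm3 q)"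
    by (simp add: quat_eq_iff plus_quat_def times_quat_def of_real_def scaleR_quat_def one_quat_def)
  then have "L q = qRe q * L 1 + qIm1 q * L ?i + qIm2 q * L ?j + qIm3 q * L ?k"
    by (metis add scale)
  \<comment> \<open>The imaginary units square to \<open>-1\<close>, hence the signs in the representing quaternion.\<close>
  then show "L q = qRe (Quat (L 1) (- L ?i) (- L ?j) (- L ?k) * q)"
    by (simp add: times_quat_def)
qed

theorem balanced_form_is_real_part:
  assumes "right_quat_space rs" and "left_quat_space V ls"
    and "balanced_real_bilinear rs V ls \<Phi>"
  shows "\<exists>\<Psi>. left_right_linear_form rs V ls \<Psi> \<and> (\<forall>x. \<forall>x'\<in>V. \<Phi> x x' = qRe (\<Psi> x' x))"
proof -
  interpret right_quat_space rs by fact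
  interpret left_quat_space V ls by fact
  have add_l: "\<Phi> (x + y) x' = \<Phi> x x' + \<Phi> y x'"
    and add_r: "y' \<in> V \<Longrightarrow> \<Phi> x (x' + y') = \<Phi> x x' + \<Phi> x y'"
    and bal: "\<Phi> (rs x q) x' = \<Phi> x (ls q x')"
    and scale: "\<Phi> (rs x (of_real r)) x' = r * \<Phi> x x'" if "x' \<in> V" for x y x' y' q r
    using assms(3) that unfolding balanced_real_bilinear_def by simp_all
  have "\<exists>c. \<forall>q. \<Phi> (rs x q) x' = qRe (c * q)" if "x' \<in> V" for x x'
    by (rule real_functional_eq_qRe_mult)
      (simp_all add: that rs_add_right add_l rs_mult scale)
  then obtain \<Psi> where rep: "qRe (\<Psi> x' x * q) = \<Phi> (rs x q) x'" if "x' \<in> V" for x x' q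
    by metis
  have "left_right_linear_form rs V ls \<Psi>"
    unfolding left_right_linear_form_def
  proof (intro conjI ballI allI; rule quat_eqI_qRe_mult)
    fix x y x' y' p q
    assume V: "x' \<in> V"
    show "qRe (\<Psi> (x' + y') x * q) = qRe ((\<Psi> x' x + \<Psi> y' x) * q)" if "y' \<in> V"
      by (simp add: V that add_mem rep add_r distrib_right qRe_add)
    show "qRe (\<Psi> x' (x + y) * q) = qRe ((\<Psi> x' x + \<Psi> x' y) * q)"
      by (simp add: V rep rs_add_left add_l distrib_right qRe_add)
    show "qRe (\<Psi> x' (rs x p) * q) = qRe (\<Psi> x' x * p * q)"
      by (simp add: V rep rs_mult mult.assoc)
    have "qRe (\<Psi> (ls p x') x * q) = \<Phi> (rs x (q * p)) x'"
      by (simp add: V ls_mem rep rs_mult bal)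
    also have "\<dots> = qRe (\<Psi> x' x * q * p)"
      by (simp add: V rep mult.assoc)
    also have "\<dots> = qRe (p * \<Psi> x' x * q)"
      by (simp add: qRe_mult_commute[of p "\<Psi> x' x * q"] mult.assoc)
    finally show "qRe (\<Psi> (ls p x') x * q) = qRe (p * \<Psi> x' x * q)" .
  qed
  moreover have "\<Phi> x x' = qRe (\<Psi> x' x)" if "x' \<in> V" for x x'
    using rep[OF that, of x 1] by (simp add: rs_one)
  ultimately show ?thesis by blast
qed

theorem theorem2p4:
  fixes rs :: "'e::ab_group_add \<Rightarrow> quat \<Rightarrow> 'e"
    and \<Phi> :: "'e \<Rightarrow> ('e \<Rightarrow> quat) \<Rightarrow> real"
  assumes "right_quat_space rs"
    and "balanced_real_bilinear rs (quat_dual rs) dual_scale \<Phi>"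
  shows "\<exists>\<Psi> :: ('e \<Rightarrow> quat) \<Rightarrow> 'e \<Rightarrow> quat.
           left_right_linear_form rs (quat_dual rs) dual_scale \<Psi> \<and>
           (\<forall>x. \<forall>x'\<in>quat_dual rs. \<Phi> x x' = qRe (\<Psi> x' x))"
  using assms(1) left_quat_space_quat_dual assms(2) by (rule balanced_form_is_real_part)

end
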